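(* Let $X$ be a locally finite poset and $K$ a field. Let $\beta\in I(X,K)$ be invertible, $\sigma\in I(X,K)$ multiplicative, $\lambda\in\mathrm{Aut}(X)$, and let $\varphi=\xi_\beta\circ\psi$ with $\psi=M_\sigma\circ\hat\lambda$. Then $$\mathrm{Der}^{\varphi}(I(X,K))=\mathrm{IDer}^{\varphi}(I(X,K))+\beta\cdot\mathrm{ADer}^{\psi}(I(X,K)).$$
   Context: A poset is locally finite if all its intervals $\{z: x\le z\le y\}$ are finite. $\mathrm{Aut}(X)$ is the group of bijections $\lambda:X\to X$ with $x\le y\iff\lambda(x)\le\lambda(y)$. The incidence algebra $I(X,K)$ is the $K$-space of functions $f:X\times X\to K$ with $f(x,y)=0$ for $x\nleq y$, with product $(fg)(x,y)=\sum_{x\le z\le y}f(x,z)g(z,y)$; it is associative and unital. For invertible $\beta\in I(X,K)$, $\xi_\beta$ is the inner automorphism $\xi_\beta(f)=\beta f\beta^{-1}$. An element $\sigma\in I(X,K)$ is multiplicative if $\sigma(x,y)\ne 0$ for all $x\le y$ and $\sigma(x,z)=\sigma(x,y)\sigma(y,z)$ whenever $x\le y\le z$; it determines the automorphism $M_\sigma$ of $I(X,K)$, $M_\sigma(f)(x,y)=\sigma(x,y)f(x,y)$. Each $\lambda\in\mathrm{Aut}(X)$ induces the automorphism $\hat\lambda$ of $I(X,K)$, $\hat\lambda(f)(x,y)=f(\lambda^{-1}(x),\lambda^{-1}(y))$. For a $K$-algebra $A$ and $\varphi\in\mathrm{Aut}(A)$, a $\varphi$-derivation of $A$ is a linear map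 $d:A\to A$ with $d(ab)=d(a)b+\varphi(a)d(b)$ for all $a,b\in A$; $\mathrm{Der}^{\varphi}(A)$ is the $K$-space of all of them. If $A$ is associative, then for $a\in A$ the map $D^\varphi_a(b)=ab-\varphi(b)a$ is an inner $\varphi$-derivation; $\mathrm{IDer}^{\varphi}(A)$ is the subspace of all inner $\varphi$-derivations. An element $\tau\in I(X,K)$ is $(\sigma,\lambda)$-additive if $\tau(x,y)=0$ whenever $\lambda(x)\nleq y$, and $\tau(x,z)=\tau(x,y)+\sigma(\lambda(x),\lambda(y))\tau(y,z)$ for all $x\le y\le z$. For such $\tau$, the map $L_\tau:I(X,K)\to I(X,K)$ is defined by $L_\tau(f)(\lambda(x),y)=\tau(x,y)f(x,y)$ for all $f\in I(X,K)$, $x,y\in X$. A $\psi$-derivation $d$ (with $\psi=M_\sigma\circ\hat\lambda$) is additive if $d=L_\tau$ for some $(\sigma,\lambda)$-additive $\tau$; $\mathrm{ADer}^{\psi}(I(X,K))$ is the set of all additive $\psi$-derivations. For a set $S$ of maps $I(X,K)\to I(X,K)$, $\beta\cdot S$ denotes $\{\beta\cdot d: d\in S\}$, where $(\beta\cdot d)(f)=\beta\, d(f)$. *)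

theory Defs
  imports Complex_Main "HOL-Library.Function_Algebras" "HOL-Library.Set_Algebras"
begin

text \<open>The poset \<open>X\<close> is the universe of a type; its order is the type's order.\<close>

class locally_finite_order = order +
  assumes finite_interval: "finite {z. x \<le> z \<and> z \<le> y}"

lemma finite_atLeastAtMost_lfo [simp]: "finite {x..y}" for x y :: "'a::locally_finite_order"
  using finite_interval[of x y] by (simp add: atLeastAtMost_def atLeast_def atMost_def Int_def)

definition order_automorphisms :: "('a::order \<Rightarrow> 'a) set" where
  "order_automorphisms = {\<alpha>. bij \<alpha> \<and> (\<forall>x y. x \<le> y \<longleftrightarrow> \<alpha> x \<le> \<alpha> y)}"

typedef (overloaded) ('a::order, 'k::zero) incidence =
    "{f :: 'a \<Rightarrow> 'a \<Rightarrow> 'k. \<forall>x y. \<not> x \<le> y \<longrightarrow> f x y = 0}"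
  morphisms entry Incidence
  by (rule exI[of _ "\<lambda>_ _. 0"]) simp

setup_lifting type_definition_incidence

lemma entry_eq_0: "\<not> x \<le> y \<Longrightarrow> entry f x y = 0"
  using entry[of f] by simp

lemma incidence_eqI: "(\<And>x y. x \<le> y \<Longrightarrow> entry f x y = entry g x y) \<Longrightarrow> f = g"
proof -
  assume eq: "\<And>x y. x \<le> y \<Longrightarrow> entry f x y = entry g x y"
  have "entry f x y = entry g x y" for x y
    by (cases "x \<le> y") (simp_all add: eq entry_eq_0)
  then have "entry f = entry g" by (intro ext)
  then show "f = g" by (simp only: entry_inject)
qed

instantiation incidence :: (order, ab_group_add) ab_group_add
begin

lift_definition zero_incidence :: "('a, 'b) incidence" is "\<lambda>_ _. 0" by simp

lift_definition plus_incidence :: "('a, 'b) incidence \<Rightarrow> ('a, 'b) incidence \<Rightarrow> ('a, 'b) incidence"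
  is "\<lambda>f g x y. f x y + g x y" by simp

lift_definition uminus_incidence :: "('a, 'b) incidence \<Rightarrow> ('a, 'b) incidence"
  is "\<lambda>f x y. - f x y" by simp

lift_definition minus_incidence :: "('a, 'b) incidence \<Rightarrow> ('a, 'b) incidence \<Rightarrow> ('a, 'b) incidence"
  is "\<lambda>f g x y. f x y - g x y" by simp

instance
  by standard
    (auto intro!: incidence_eqI simp: zero_incidence.rep_eq plus_incidence.rep_eq
      uminus_incidence.rep_eq minus_incidence.rep_eq add.assoc add.commute)

end

instantiation incidence :: (locally_finite_order, ring_1) ring_1
begin

lift_definition one_incidence :: "('a, 'b) incidence" is "\<lambda>x y. if x = y then 1 else 0"
  by auto

lift_definition times_incidence :: "('a, 'b) incidence \<Rightarrow> ('a, 'b) incidence \<Rightarrow> ('a, 'b) incidence"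
  is "\<lambda>f g x y. \<Sum>z\<in>{x..y}. f x z * g z y"
  by simp

instance
proof
  fix f g h :: "('a, 'b) incidence"
  show "f * g * h = f * (g * h)"
  proof (rule incidence_eqI)
    fix x y :: 'a
    have "entry (f * g * h) x y
        = (\<Sum>z\<in>{x..y}. \<Sum>w | w \<in> {x..y} \<and> w \<le> z. entry f x w * entry g w z * entry h z y)"
      unfolding times_incidence.rep_eq sum_distrib_right
      by (intro sum.cong refl) (auto intro: order_trans)
    also have "\<dots> = (\<Sum>w\<in>{x..y}. \<Sum>z | z \<in> {x..y} \<and> w \<le> z. entry f x w * entry g w z * entry h z y)"
      by (rule sum.swap_restrict) simp_all
    also have "\<dots> = entry (f * (g * h)) x y"
      unfolding times_incidence.rep_eq sum_distrib_left mult.assoc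
      by (intro sum.cong refl) (auto intro: order_trans)
    finally show "entry (f * g * h) x y = entry (f * (g * h)) x y" .
  qed
  show "1 * f = f"
    by (rule incidence_eqI)
       (simp add: times_incidence.rep_eq one_incidence.rep_eq if_distrib[of "\<lambda>c. c * _"] cong: if_cong)
  show "f * 1 = f"
    by (rule incidence_eqI)
       (simp add: times_incidence.rep_eq one_incidence.rep_eq if_distrib[of "\<lambda>c. _ * c"] cong: if_cong)
  show "(f + g) * h = f * h + g * h"
    by (rule incidence_eqI)
       (simp add: times_incidence.rep_eq plus_incidence.rep_eq distrib_right sum.distrib)
  show "f * (g + h) = f * g + f * h"
    by (rule incidence_eqI)
       (simp add: times_incidence.rep_eq plus_incidence.rep_eq distrib_left sum.distrib)
  show "(0 :: ('a, 'b) incidence) \<noteq> 1"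
    by (metis one_incidence.rep_eq zero_incidence.rep_eq zero_neq_one)
qed

end

lift_definition scale_incidence ::
    "'k::field \<Rightarrow> ('a::order, 'k) incidence \<Rightarrow> ('a, 'k) incidence"
  is "\<lambda>c f x y. c * f x y" by simp

lemma vector_space_incidence: "vector_space scale_incidence"
  by standard
    (auto intro!: incidence_eqI simp: scale_incidence.rep_eq plus_incidence.rep_eq
      distrib_left distrib_right mult.assoc)

definition twisted_derivations ::
    "('k::field \<Rightarrow> 'r::ring_1 \<Rightarrow> 'r) \<Rightarrow> ('r \<Rightarrow> 'r) \<Rightarrow> ('r \<Rightarrow> 'r) set" where
  "twisted_derivations scale \<phi> =
     {d. Vector_Spaces.linear scale scale d \<and> (\<forall>a b. d (a * b) = d a * b + \<phi> a * d b)}"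

definition inner_twisted_derivation :: "('r::ring_1 \<Rightarrow> 'r) \<Rightarrow> 'r \<Rightarrow> 'r \<Rightarrow> 'r" where
  "inner_twisted_derivation \<phi> a = (\<lambda>b. a * b - \<phi> b * a)"

definition inner_twisted_derivations :: "('r::ring_1 \<Rightarrow> 'r) \<Rightarrow> ('r \<Rightarrow> 'r) set" where
  "inner_twisted_derivations \<phi> = range (inner_twisted_derivation \<phi>)"

definition left_multiples :: "'r::ring_1 \<Rightarrow> ('r \<Rightarrow> 'r) set \<Rightarrow> ('r \<Rightarrow> 'r) set" where
  "left_multiples \<beta> S = (\<lambda>d f. \<beta> * d f) ` S"

definition invertible_elem :: "'r::ring_1 \<Rightarrow> bool" where
  "invertible_elem a \<longleftrightarrow> (\<exists>b. a * b = 1 \<and> b * a = 1)"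

definition inverse_elem :: "'r::ring_1 \<Rightarrow> 'r" where
  "inverse_elem a = (THE b. a * b = 1 \<and> b * a = 1)"

lemma inverse_elem:
  assumes "invertible_elem a"
  shows "a * inverse_elem a = 1" "inverse_elem a * a = 1"
proof -
  obtain b where b: "a * b = 1" "b * a = 1"
    using assms by (auto simp: invertible_elem_def)
  have unique: "c = b" if c: "a * c = 1 \<and> c * a = 1" for c
  proof -
    have "c = (b * a) * c" using b(2) by simp
    also have "\<dots> = b * (a * c)" by (rule mult.assoc)
    finally show "c = b" using c by simp
  qed
  have "inverse_elem a = b"
    unfolding inverse_elem_def
  proof (rule the_equality)
    show "a * b = 1 \<and> b * a = 1" using b by (rule conjI)
  qed (rule unique)
  then show "a * inverse_elem a = 1" "inverse_elem a * a = 1"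
    by (simp_all only: b)
qed

definition inner_auto :: "'r::ring_1 \<Rightarrow> 'r \<Rightarrow> 'r" where
  "inner_auto \<beta> f = \<beta> * f * inverse_elem \<beta>"

definition multiplicative :: "('a::order, 'k::field) incidence \<Rightarrow> bool" where
  "multiplicative \<sigma> \<longleftrightarrow>
     (\<forall>x y. x \<le> y \<longrightarrow> entry \<sigma> x y \<noteq> 0) \<and>
     (\<forall>x y z. x \<le> y \<and> y \<le> z \<longrightarrow> entry \<sigma> x z = entry \<sigma> x y * entry \<sigma> y z)"

lift_definition mult_auto ::
    "('a::order, 'k::field) incidence \<Rightarrow> ('a, 'k) incidence \<Rightarrow> ('a, 'k) incidence"
  is "\<lambda>\<sigma> f x y. \<sigma> x y * f x y" by simp

definition induced_auto ::
    "('a::order \<Rightarrow> 'a) \<Rightarrow> ('a, 'k::field) incidence \<Rightarrow> ('a, 'k) incidence" where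
  "induced_auto \<alpha> f = Incidence (\<lambda>x y. entry f (inv \<alpha> x) (inv \<alpha> y))"

lemma inv_order_automorphism_le:
  assumes "\<alpha> \<in> order_automorphisms"
  shows "inv \<alpha> x \<le> inv \<alpha> y \<longleftrightarrow> x \<le> y"
proof -
  have "surj \<alpha>" and le: "\<alpha> (inv \<alpha> x) \<le> \<alpha> (inv \<alpha> y) \<longleftrightarrow> inv \<alpha> x \<le> inv \<alpha> y"
    using assms by (auto simp: order_automorphisms_def bij_is_surj)
  then show ?thesis by (simp add: surj_f_inv_f)
qed

lemma entry_induced_auto:
  assumes "\<alpha> \<in> order_automorphisms"
  shows "entry (induced_auto \<alpha> f) x y = entry f (inv \<alpha> x) (inv \<alpha> y)"
  unfolding induced_auto_def
  by (subst Incidence_inverse) (auto simp: entry_eq_0 inv_order_automorphism_le[OF assms])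

definition additive_elem ::
    "('a::order, 'k::field) incidence \<Rightarrow> ('a \<Rightarrow> 'a) \<Rightarrow> ('a, 'k) incidence \<Rightarrow> bool" where
  "additive_elem \<sigma> \<alpha> \<tau> \<longleftrightarrow>
     (\<forall>x y. \<not> \<alpha> x \<le> y \<longrightarrow> entry \<tau> x y = 0) \<and>
     (\<forall>x y z. x \<le> y \<and> y \<le> z \<longrightarrow>
        entry \<tau> x z = entry \<tau> x y + entry \<sigma> (\<alpha> x) (\<alpha> y) * entry \<tau> y z)"

text \<open>
  The map sending \<open>f\<close> to the element whose entry at \<open>(\<alpha> x, y)\<close> is \<open>\<tau> x y * f x y\<close>. It is
  meaningful only for a bijection \<open>\<alpha>\<close> and a \<open>\<tau>\<close> with \<open>\<tau> x y = 0\<close> whenever \<open>\<alpha> x \<le> y\<close> fails;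
  see \<open>entry_additive_map\<close>.
\<close>

definition additive_map ::
    "('a::order \<Rightarrow> 'a) \<Rightarrow> ('a, 'k::field) incidence \<Rightarrow> ('a, 'k) incidence \<Rightarrow> ('a, 'k) incidence" where
  "additive_map \<alpha> \<tau> f = Incidence (\<lambda>u y. entry \<tau> (inv \<alpha> u) y * entry f (inv \<alpha> u) y)"

lemma entry_additive_map:
  assumes "\<alpha> \<in> order_automorphisms" "additive_elem \<sigma> \<alpha> \<tau>"
  shows "entry (additive_map \<alpha> \<tau> f) (\<alpha> x) y = entry \<tau> x y * entry f x y"
proof -
  have bij: "bij \<alpha>" using assms(1) by (simp add: order_automorphisms_def)
  have "entry \<tau> (inv \<alpha> u) v = 0" if "\<not> u \<le> v" for u v
    using assms(2) that bij by (simp add: additive_elem_def bij_is_surj surj_f_inv_f)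
  then have "entry (additive_map \<alpha> \<tau> f) = (\<lambda>u y. entry \<tau> (inv \<alpha> u) y * entry f (inv \<alpha> u) y)"
    unfolding additive_map_def by (subst Incidence_inverse) auto
  with bij show ?thesis by (simp add: bij_is_inj)
qed

text \<open>The twist is \<open>\<psi> = mult_auto \<sigma> \<circ> induced_auto \<alpha>\<close>, which is why \<open>\<sigma>\<close> and \<open>\<alpha>\<close> are the parameters.\<close>

definition additive_twisted_derivations ::
    "('a::locally_finite_order, 'k::field) incidence \<Rightarrow> ('a \<Rightarrow> 'a)
      \<Rightarrow> (('a, 'k) incidence \<Rightarrow> ('a, 'k) incidence) set" where
  "additive_twisted_derivations \<sigma> \<alpha> =
     {d \<in> twisted_derivations scale_incidence (mult_auto \<sigma> \<circ> induced_auto \<alpha>).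
        \<exists>\<tau>. additive_elem \<sigma> \<alpha> \<tau> \<and> d = additive_map \<alpha> \<tau>}"

end

theory Submission
  imports Defs
begin

text \<open>
  Left multiplication by \<open>\<beta>\<close> turns a \<open>\<psi>\<close>-derivation into a \<open>\<xi>\<^sub>\<beta> \<circ> \<psi>\<close>-derivation, because the
  factor \<open>\<beta>\<close> moves past \<open>\<psi> a\<close> at the price of a conjugation. This is a bijection, with inverse the left
  multiplication by \<open>\<beta>\<^sup>-\<^sup>1\<close>, and it respects inner derivations: \<open>\<beta> \<cdot> D\<^sup>\<psi>\<^sub>a = D\<^sup>\<phi>\<^sub>c\<close>
  with \<open>c = \<beta> a\<close>. Hence everything reduces to \<open>Der\<^sup>\<psi> = IDer\<^sup>\<psi> + ADer\<^sup>\<psi>\<close>, which is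
  \<open>twisted_derivations_inner_plus_additive\<close>.

  For this, let \<open>e\<^sub>x\<^sub>y\<close> be the matrix units and \<open>e\<^sub>x = e\<^sub>x\<^sub>x\<close>. The automorphism \<open>\<psi>\<close> sends \<open>e\<^sub>x\<close> to the
  idempotent at \<open>\<alpha> x\<close>. Differentiating the relations \<open>e\<^sub>x e\<^sub>x = e\<^sub>x\<close> and \<open>e\<^sub>x e\<^sub>y = 0\<close> shows that the values of
  a \<open>\<psi>\<close>-derivation \<open>d\<close> on all these idempotents are those of one inner derivation, given by the
  element \<open>a\<close> whose column \<open>v\<close> is the column \<open>v\<close> of \<open>d e\<^sub>v\<close>. So \<open>D = d - D\<^sup>\<psi>\<^sub>a\<close> vanishes on every \<open>e\<^sub>x\<close>
  and therefore satisfies \<open>D (e\<^sub>x f e\<^sub>y) = \<psi> e\<^sub>x \<cdot> D f \<cdot> e\<^sub>y\<close>. As \<open>e\<^sub>x f e\<^sub>y\<close> is a multiple of \<open>e\<^sub>x\<^sub>y\<close>, the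
  entry of \<open>D f\<close> at \<open>(\<alpha> x, y)\<close> is \<open>f x y\<close> times a constant \<open>\<tau> x y\<close>, and \<open>D\<close> applied to
  \<open>e\<^sub>x\<^sub>y e\<^sub>y\<^sub>z = e\<^sub>x\<^sub>z\<close> gives the additivity of \<open>\<tau>\<close>. Over an infinite
  poset \<open>f\<close> need not be a finite combination of matrix units, but each single entry of \<open>D f\<close> is
  reached by cutting with two idempotents, and so \<open>\<tau>\<close> still determines \<open>D\<close> on the whole algebra.
\<close>

section \<open>Twisted derivations of an associative algebra\<close>

locale associative_algebra = vector_space scale
  for scale :: "'k::field \<Rightarrow> 'r::ring_1 \<Rightarrow> 'r" +
  assumes mult_scale_left: "scale c a * b = scale c (a * b)"
    and mult_scale_right: "a * scale c b = scale c (a * b)"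
begin

lemma twisted_derivations_iff:
  "d \<in> twisted_derivations scale \<phi> \<longleftrightarrow>
     (\<forall>a b. d (a + b) = d a + d b) \<and> (\<forall>c a. d (scale c a) = scale c (d a)) \<and>
     (\<forall>a b. d (a * b) = d a * b + \<phi> a * d b)"
  by (auto simp: twisted_derivations_def Vector_Spaces.linear_iff vector_space_axioms)

lemma twisted_derivations_plus:
  assumes "d \<in> twisted_derivations scale \<phi>" "d' \<in> twisted_derivations scale \<phi>"
  shows "d + d' \<in> twisted_derivations scale \<phi>"
  using assms by (simp add: twisted_derivations_iff scale_right_distrib algebra_simps)

lemma twisted_derivations_minus:
  assumes "d \<in> twisted_derivations scale \<phi>" "d' \<in> twisted_derivations scale \<phi>"
  shows "d - d' \<in> twisted_derivations scale \<phi>"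
  using assms by (simp add: twisted_derivations_iff scale_right_diff_distrib algebra_simps)

lemma inner_twisted_derivation_in_twisted_derivations:
  assumes add: "\<And>a b. \<phi> (a + b) = \<phi> a + \<phi> b"
    and scale: "\<And>c a. \<phi> (scale c a) = scale c (\<phi> a)"
    and mult: "\<And>a b. \<phi> (a * b) = \<phi> a * \<phi> b"
  shows "inner_twisted_derivation \<phi> a \<in> twisted_derivations scale \<phi>"
  unfolding twisted_derivations_iff inner_twisted_derivation_def
  by (simp add: add scale mult mult_scale_left mult_scale_right scale_right_diff_distrib algebra_simps)

text \<open>
  The relation \<open>\<gamma> \<beta> = 1\<close> gives \<open>\<beta> \<psi> a \<cdot> d b = (\<beta> \<psi> a \<gamma>) \<cdot> (\<beta> \<cdot> d b)\<close>. Taking \<open>\<beta>, \<beta>\<^sup>-\<^sup>1\<close> and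
  \<open>\<beta>\<^sup>-\<^sup>1, \<beta>\<close> for \<open>\<beta>, \<gamma>\<close> yields the passage from \<open>\<psi>\<close> to the conjugated twist and the way back.
\<close>

lemma left_multiple_twisted_derivation:
  assumes "\<gamma> * \<beta> = 1" "d \<in> twisted_derivations scale \<psi>"
  shows "(\<lambda>f. \<beta> * d f) \<in> twisted_derivations scale (\<lambda>f. \<beta> * \<psi> f * \<gamma>)"
proof -
  have cancel: "\<gamma> * (\<beta> * f) = f" for f
    using assms(1) by (simp flip: mult.assoc)
  show ?thesis
    using assms(2)
    by (simp add: twisted_derivations_iff mult_scale_right distrib_left mult.assoc cancel)
qed

lemma left_multiples_twisted_derivations:
  assumes "invertible_elem \<beta>"
  shows "left_multiples \<beta> (twisted_derivations scale \<psi>) =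
    twisted_derivations scale (inner_auto \<beta> \<circ> \<psi>)"
proof
  note inv = inverse_elem[OF assms]
  have cancel: "inverse_elem \<beta> * (\<beta> * f) = f" "\<beta> * (inverse_elem \<beta> * f) = f" for f
    using inv by (simp_all flip: mult.assoc)
  have conj: "inner_auto \<beta> \<circ> \<psi> = (\<lambda>f. \<beta> * \<psi> f * inverse_elem \<beta>)"
    by (simp add: fun_eq_iff inner_auto_def)
  show "left_multiples \<beta> (twisted_derivations scale \<psi>)
      \<subseteq> twisted_derivations scale (inner_auto \<beta> \<circ> \<psi>)"
    unfolding left_multiples_def conj
    using left_multiple_twisted_derivation[OF inv(2)] by blast
  show "twisted_derivations scale (inner_auto \<beta> \<circ> \<psi>)
      \<subseteq> left_multiples \<beta> (twisted_derivations scale \<psi>)"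
  proof
    fix d assume "d \<in> twisted_derivations scale (inner_auto \<beta> \<circ> \<psi>)"
    from left_multiple_twisted_derivation[OF inv(1) this]
    have "(\<lambda>f. inverse_elem \<beta> * d f) \<in> twisted_derivations scale \<psi>"
      by (simp add: inner_auto_def mult.assoc cancel inv)
    moreover have "d = (\<lambda>f. \<beta> * (inverse_elem \<beta> * d f))"
      by (simp add: cancel)
    ultimately show "d \<in> left_multiples \<beta> (twisted_derivations scale \<psi>)"
      unfolding left_multiples_def by (intro image_eqI)
  qed
qed

end

lemma left_multiples_inner_twisted_derivations:
  fixes \<beta> :: "'r::ring_1"
  assumes "invertible_elem \<beta>"
  shows "left_multiples \<beta> (inner_twisted_derivations \<psi>) =
    inner_twisted_derivations (inner_auto \<beta> \<circ> \<psi>)"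
proof -
  note inv = inverse_elem[OF assms]
  have cancel: "inverse_elem \<beta> * (\<beta> * f) = f" for f
    using inv by (simp flip: mult.assoc)
  have "(\<lambda>f. \<beta> * inner_twisted_derivation \<psi> a f) =
      inner_twisted_derivation (inner_auto \<beta> \<circ> \<psi>) (\<beta> * a)" for a
    by (simp add: fun_eq_iff inner_twisted_derivation_def inner_auto_def right_diff_distrib
        mult.assoc cancel)
  then have "left_multiples \<beta> (inner_twisted_derivations \<psi>) =
      inner_twisted_derivation (inner_auto \<beta> \<circ> \<psi>) ` range (\<lambda>a. \<beta> * a)"
    by (simp add: left_multiples_def inner_twisted_derivations_def image_image)
  moreover have "surj (\<lambda>a. \<beta> * a)"
    by (rule surjI[where f = "\<lambda>a. inverse_elem \<beta> * a"]) (simp add: inv flip: mult.assoc)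
  ultimately show ?thesis
    by (simp add: inner_twisted_derivations_def)
qed

lemma left_multiples_set_plus:
  "left_multiples \<beta> (S + T) = left_multiples \<beta> S + left_multiples \<beta> T"
proof -
  have "(\<lambda>f. \<beta> * (d + d') f) = (\<lambda>f. \<beta> * d f) + (\<lambda>f. \<beta> * d' f)" for d d'
    by (simp add: fun_eq_iff distrib_left)
  then show ?thesis
    unfolding left_multiples_def set_plus_image image_image split_def
    by (force simp: image_iff)
qed

section \<open>The incidence algebra and its matrix units\<close>

interpretation incidence: associative_algebra
  "scale_incidence :: 'k::field \<Rightarrow> ('a::locally_finite_order, 'k) incidence \<Rightarrow> _"
proof (intro associative_algebra.intro vector_space_incidence associative_algebra_axioms.intro)
  fix c :: 'k and f g :: "('a, 'k) incidence"
  show "scale_incidence c f * g = scale_incidence c (f * g)"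
    "f * scale_incidence c g = scale_incidence c (f * g)"
    by (rule incidence_eqI;
        simp add: times_incidence.rep_eq scale_incidence.rep_eq sum_distrib_left algebra_simps)+
qed

text \<open>With value zero unless \<open>x \<le> y\<close>, the equation \<open>e\<^sub>x f e\<^sub>y = f x y \<cdot> e\<^sub>x\<^sub>y\<close> of \<open>idempotent_cut\<close>
  holds for all pairs of indices.\<close>

lift_definition matrix_unit :: "'a::order \<Rightarrow> 'a \<Rightarrow> ('a, 'k::zero_neq_one) incidence"
  is "\<lambda>x y u v. if x \<le> y \<and> u = x \<and> v = y then 1 else 0"
  by auto

lemma matrix_unit_eq_0: "\<not> x \<le> y \<Longrightarrow> matrix_unit x y = (0 :: ('a::order, 'k::ring_1) incidence)"
  by (rule incidence_eqI) (simp add: matrix_unit.rep_eq zero_incidence.rep_eq)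

lemma entry_mult_matrix_unit:
  fixes f :: "('a::locally_finite_order, 'k::ring_1) incidence"
  assumes "y \<le> z"
  shows "entry (f * matrix_unit y z) u v = (if v = z then entry f u y else 0)"
proof -
  have "entry (f * matrix_unit y z) u v =
      (\<Sum>w\<in>{u..v}. if w = y then (if v = z then entry f u y else 0) else 0)"
    unfolding times_incidence.rep_eq matrix_unit.rep_eq by (intro sum.cong) (auto simp: assms)
  also have "\<dots> = (if v = z then entry f u y else 0)"
    using assms by (auto simp: entry_eq_0)
  finally show ?thesis .
qed

lemma entry_matrix_unit_mult:
  fixes f :: "('a::locally_finite_order, 'k::ring_1) incidence"
  assumes "x \<le> y"
  shows "entry (matrix_unit x y * f) u v = (if u = x then entry f y v else 0)"
proof -
  have "entry (matrix_unit x y * f) u v =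
      (\<Sum>w\<in>{u..v}. if w = y then (if u = x then entry f y v else 0) else 0)"
    unfolding times_incidence.rep_eq matrix_unit.rep_eq by (intro sum.cong) (auto simp: assms)
  also have "\<dots> = (if u = x then entry f y v else 0)"
    using assms by (auto simp: entry_eq_0)
  finally show ?thesis .
qed

lemma matrix_unit_mult_matrix_unit:
  fixes x y z :: "'a::locally_finite_order"
  assumes "x \<le> y" "y \<le> z"
  shows "matrix_unit x y * matrix_unit y z = (matrix_unit x z :: ('a, 'k::ring_1) incidence)"
  using assms
  by (intro incidence_eqI) (auto simp: entry_mult_matrix_unit matrix_unit.rep_eq)

lemma idempotents_orthogonal:
  fixes x y :: "'a::locally_finite_order"
  assumes "x \<noteq> y"
  shows "matrix_unit x x * matrix_unit y y = (0 :: ('a, 'k::ring_1) incidence)"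
  using assms
  by (intro incidence_eqI)
     (auto simp: entry_mult_matrix_unit matrix_unit.rep_eq zero_incidence.rep_eq)

lemma idempotent_cut:
  fixes f :: "('a::locally_finite_order, 'k::field) incidence"
  shows "matrix_unit x x * f * matrix_unit y y = scale_incidence (entry f x y) (matrix_unit x y)"
  by (intro incidence_eqI)
     (auto simp: entry_mult_matrix_unit entry_matrix_unit_mult scale_incidence.rep_eq
       matrix_unit.rep_eq)

section \<open>The automorphism attached to a multiplicative element and an order automorphism\<close>

context
  fixes \<sigma> :: "('a::locally_finite_order, 'k::field) incidence" and \<alpha> :: "'a \<Rightarrow> 'a"
    and \<psi> :: "('a, 'k) incidence \<Rightarrow> ('a, 'k) incidence"
  assumes multiplicative: "multiplicative \<sigma>"
    and order_automorphism: "\<alpha> \<in> order_automorphisms"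
    and twist: "\<psi> = mult_auto \<sigma> \<circ> induced_auto \<alpha>"
begin

lemma inv_alpha [simp]: "inv \<alpha> (\<alpha> x) = x" "\<alpha> (inv \<alpha> x) = x"
  using order_automorphism
  by (simp_all add: order_automorphisms_def bij_is_inj bij_is_surj surj_f_inv_f)

lemma alpha_le_iff [simp]: "\<alpha> x \<le> \<alpha> y \<longleftrightarrow> x \<le> y"
  using order_automorphism by (simp add: order_automorphisms_def)

lemma sigma_diag [simp]: "entry \<sigma> x x = 1"
  using multiplicative unfolding multiplicative_def
  by (metis mult_cancel_left1 order_refl)

lemma incidence_eqI_alpha:
  assumes "\<And>x y. entry f (\<alpha> x) y = entry g (\<alpha> x) y"
  shows "f = g"
  by (rule incidence_eqI) (metis assms inv_alpha(2))

lemma entry_twist: "entry (\<psi> f) u v = entry \<sigma> u v * entry f (inv \<alpha> u) (inv \<alpha> v)"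
  by (simp add: twist mult_auto.rep_eq entry_induced_auto[OF order_automorphism])

lemma twist_plus: "\<psi> (f + g) = \<psi> f + \<psi> g"
  by (rule incidence_eqI) (simp add: entry_twist plus_incidence.rep_eq distrib_left)

lemma twist_scale: "\<psi> (scale_incidence c f) = scale_incidence c (\<psi> f)"
  by (rule incidence_eqI) (simp add: entry_twist scale_incidence.rep_eq)

lemma twist_mult: "\<psi> (f * g) = \<psi> f * \<psi> g"
proof (rule incidence_eqI)
  fix u v :: 'a
  have "entry (\<psi> (f * g)) u v =
      (\<Sum>z\<in>{inv \<alpha> u..inv \<alpha> v}. entry \<sigma> u v * (entry f (inv \<alpha> u) z * entry g z (inv \<alpha> v)))"
    by (simp add: entry_twist times_incidence.rep_eq sum_distrib_left)
  also have "\<dots> = (\<Sum>w\<in>{u..v}. entry (\<psi> f) u w * entry (\<psi> g) w v)"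
  proof (rule sum.reindex_bij_witness[where i = "inv \<alpha>" and j = \<alpha>])
    fix z assume z: "z \<in> {inv \<alpha> u..inv \<alpha> v}"
    then have le: "u \<le> \<alpha> z" "\<alpha> z \<le> v"
      by (metis alpha_le_iff atLeastAtMost_iff inv_alpha(2))+
    then show "\<alpha> z \<in> {u..v}" by simp
    have "entry \<sigma> u v = entry \<sigma> u (\<alpha> z) * entry \<sigma> (\<alpha> z) v"
      using multiplicative le by (auto simp: multiplicative_def)
    then show "entry (\<psi> f) u (\<alpha> z) * entry (\<psi> g) (\<alpha> z) v =
        entry \<sigma> u v * (entry f (inv \<alpha> u) z * entry g z (inv \<alpha> v))"
      by (simp add: entry_twist)
  qed (simp_all add: inv_order_automorphism_le[OF order_automorphism])
  finally show "entry (\<psi> (f * g)) u v = entry (\<psi> f * \<psi> g) u v"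
    by (simp add: times_incidence.rep_eq)
qed

lemma twist_matrix_unit:
  "\<psi> (matrix_unit x y) = scale_incidence (entry \<sigma> (\<alpha> x) (\<alpha> y)) (matrix_unit (\<alpha> x) (\<alpha> y))"
proof (rule incidence_eqI)
  fix u v :: 'a
  have "inv \<alpha> u = x \<longleftrightarrow> u = \<alpha> x" "inv \<alpha> v = y \<longleftrightarrow> v = \<alpha> y"
    by auto
  then show "entry (\<psi> (matrix_unit x y)) u v =
      entry (scale_incidence (entry \<sigma> (\<alpha> x) (\<alpha> y)) (matrix_unit (\<alpha> x) (\<alpha> y))) u v"
    by (simp add: entry_twist scale_incidence.rep_eq matrix_unit.rep_eq)
qed

lemma entry_twist_matrix_unit_mult:
  assumes "x \<le> y"
  shows "entry (\<psi> (matrix_unit x y) * f) u v =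
    (if u = \<alpha> x then entry \<sigma> (\<alpha> x) (\<alpha> y) * entry f (\<alpha> y) v else 0)"
  using assms
  by (simp add: twist_matrix_unit incidence.mult_scale_left scale_incidence.rep_eq
      entry_matrix_unit_mult)

section \<open>Decomposition of the derivations twisted by this automorphism\<close>

text \<open>
  By comparison of entries in \<open>d e\<^sub>x = d e\<^sub>x \<cdot> e\<^sub>x + \<psi> e\<^sub>x \<cdot> d e\<^sub>x\<close>, the element \<open>d e\<^sub>x\<close> is supported on column \<open>x\<close> and
  row \<open>\<alpha> x\<close>, and its entry \<open>t\<close> at their crossing satisfies \<open>t = t + t\<close>. The column is the one copied
  into the element \<open>a\<close>; the row agrees with that of \<open>- a\<close> because
  \<open>d e\<^sub>x \<cdot> e\<^sub>v + \<psi> e\<^sub>x \<cdot> d e\<^sub>v = 0\<close> for \<open>v \<noteq> x\<close>.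
\<close>

lemma twisted_derivation_inner_on_idempotents:
  assumes d: "d \<in> twisted_derivations scale_incidence \<psi>"
  obtains a where "\<And>x. d (matrix_unit x x) = inner_twisted_derivation \<psi> a (matrix_unit x x)"
proof
  define a where "a = Incidence (\<lambda>u v. entry (d (matrix_unit v v)) u v)"
  have entry_a: "entry a u v = entry (d (matrix_unit v v)) u v" for u v
    unfolding a_def by (subst Incidence_inverse) (auto simp: entry_eq_0)
  have leibniz: "d (f * g) = d f * g + \<psi> f * d g" for f g
    using d by (simp add: incidence.twisted_derivations_iff)
  have d_0: "d 0 = 0"
    using d by (metis (no_types) add_cancel_right_right incidence.twisted_derivations_iff)
  have diag: "entry (d (matrix_unit x x)) u v =
      (if v = x then entry (d (matrix_unit x x)) u x else 0) +
      (if u = \<alpha> x then entry (d (matrix_unit x x)) (\<alpha> x) v else 0)" for x u v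
    using arg_cong[OF leibniz[of "matrix_unit x x" "matrix_unit x x"], of "\<lambda>f. entry f u v"]
    by (simp add: matrix_unit_mult_matrix_unit plus_incidence.rep_eq entry_mult_matrix_unit
        entry_twist_matrix_unit_mult)
  have crossing: "entry (d (matrix_unit x x)) (\<alpha> x) x = 0" for x
    using diag[of x "\<alpha> x" x] unfolding if_P[OF refl] by (simp only: add_cancel_right_right)
  have row: "entry (d (matrix_unit x x)) (\<alpha> x) v = - entry (d (matrix_unit v v)) (\<alpha> x) v"
    if "x \<noteq> v" for x v
    using arg_cong[OF leibniz[of "matrix_unit x x" "matrix_unit v v"], of "\<lambda>f. entry f (\<alpha> x) v"] that
    by (simp add: eq_neg_iff_add_eq_0 idempotents_orthogonal d_0 zero_incidence.rep_eq plus_incidence.rep_eq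
        entry_mult_matrix_unit entry_twist_matrix_unit_mult)
  show "d (matrix_unit x x) = inner_twisted_derivation \<psi> a (matrix_unit x x)" for x
  proof (rule incidence_eqI)
    fix u v :: 'a
    have "entry (inner_twisted_derivation \<psi> a (matrix_unit x x)) u v =
        (if v = x then entry (d (matrix_unit x x)) u x else 0) -
        (if u = \<alpha> x then entry (d (matrix_unit v v)) (\<alpha> x) v else 0)"
      by (simp add: inner_twisted_derivation_def minus_incidence.rep_eq entry_mult_matrix_unit
          entry_twist_matrix_unit_mult entry_a)
    then show "entry (d (matrix_unit x x)) u v =
        entry (inner_twisted_derivation \<psi> a (matrix_unit x x)) u v"
      using diag[of x u v] crossing[of x] row[of x v] by (cases "v = x") auto
  qed
qed

text \<open>
  A derivation killing the idempotents commutes with cutting by them, so it acts entry by entry; its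
  multiplier \<open>\<tau>\<close> is read off from the matrix units.
\<close>

lemma additive_if_zero_on_idempotents:
  assumes D: "D \<in> twisted_derivations scale_incidence \<psi>"
    and zero: "\<And>x. D (matrix_unit x x) = 0"
  shows "D \<in> additive_twisted_derivations \<sigma> \<alpha>"
proof -
  define \<tau> where "\<tau> = Incidence (\<lambda>x y. entry (D (matrix_unit x y)) (\<alpha> x) y)"
  have leibniz: "D (f * g) = D f * g + \<psi> f * D g"
    and D_scale: "D (scale_incidence c f) = scale_incidence c (D f)" for f g c
    using D by (simp_all add: incidence.twisted_derivations_iff)
  have D_0: "D 0 = 0"
    using D by (metis (no_types) add_cancel_right_right incidence.twisted_derivations_iff)
  have entry_\<tau>: "entry \<tau> x y = entry (D (matrix_unit x y)) (\<alpha> x) y" for x y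
    unfolding \<tau>_def
    by (subst Incidence_inverse) (auto simp: matrix_unit_eq_0 D_0 zero_incidence.rep_eq)
  have entrywise: "entry (D f) (\<alpha> x) y = entry \<tau> x y * entry f x y" for f x y
  proof -
    have "entry (D f) (\<alpha> x) y = entry (\<psi> (matrix_unit x x) * D f * matrix_unit y y) (\<alpha> x) y"
      by (simp add: entry_mult_matrix_unit entry_twist_matrix_unit_mult)
    also have "\<psi> (matrix_unit x x) * D f * matrix_unit y y = D (matrix_unit x x * f * matrix_unit y y)"
      by (simp add: leibniz zero)
    also have "\<dots> = scale_incidence (entry f x y) (D (matrix_unit x y))"
      by (simp add: idempotent_cut D_scale)
    finally show ?thesis
      by (simp add: scale_incidence.rep_eq entry_\<tau> mult.commute)
  qed
  have additive: "additive_elem \<sigma> \<alpha> \<tau>"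
    unfolding additive_elem_def
  proof (intro conjI allI impI)
    fix x y assume "\<not> \<alpha> x \<le> y"
    then show "entry \<tau> x y = 0" by (simp add: entry_\<tau> entry_eq_0)
  next
    fix x y z :: 'a assume "x \<le> y \<and> y \<le> z"
    then show "entry \<tau> x z = entry \<tau> x y + entry \<sigma> (\<alpha> x) (\<alpha> y) * entry \<tau> y z"
      using arg_cong[OF leibniz[of "matrix_unit x y" "matrix_unit y z"], of "\<lambda>f. entry f (\<alpha> x) z"]
      by (simp add: matrix_unit_mult_matrix_unit plus_incidence.rep_eq entry_mult_matrix_unit
          entry_twist_matrix_unit_mult entry_\<tau>)
  qed
  have "D = additive_map \<alpha> \<tau>"
  proof
    fix f
    show "D f = additive_map \<alpha> \<tau> f"
      by (rule incidence_eqI_alpha)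
         (simp add: entrywise entry_additive_map[OF order_automorphism additive])
  qed
  with D additive show ?thesis
    by (auto simp: additive_twisted_derivations_def twist)
qed

lemma twisted_derivations_inner_plus_additive:
  "twisted_derivations scale_incidence \<psi> =
    inner_twisted_derivations \<psi> + additive_twisted_derivations \<sigma> \<alpha>"
proof
  have inner: "inner_twisted_derivation \<psi> a \<in> twisted_derivations scale_incidence \<psi>" for a
    by (intro incidence.inner_twisted_derivation_in_twisted_derivations
        twist_plus twist_scale twist_mult)
  show "twisted_derivations scale_incidence \<psi>
      \<subseteq> inner_twisted_derivations \<psi> + additive_twisted_derivations \<sigma> \<alpha>"
  proof
    fix d assume d: "d \<in> twisted_derivations scale_incidence \<psi>"
    then obtain a where a: "\<And>x. d (matrix_unit x x) = inner_twisted_derivation \<psi> a (matrix_unit x x)"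
      by (rule twisted_derivation_inner_on_idempotents) blast
    have "d - inner_twisted_derivation \<psi> a \<in> additive_twisted_derivations \<sigma> \<alpha>"
      using d inner a
      by (intro additive_if_zero_on_idempotents incidence.twisted_derivations_minus) simp_all
    then have "inner_twisted_derivation \<psi> a + (d - inner_twisted_derivation \<psi> a)
        \<in> inner_twisted_derivations \<psi> + additive_twisted_derivations \<sigma> \<alpha>"
      by (intro set_plus_intro) (simp_all add: inner_twisted_derivations_def)
    then show "d \<in> inner_twisted_derivations \<psi> + additive_twisted_derivations \<sigma> \<alpha>"
      by simp
  qed
  show "inner_twisted_derivations \<psi> + additive_twisted_derivations \<sigma> \<alpha>
      \<subseteq> twisted_derivations scale_incidence \<psi>"
    using inner
    by (auto simp: inner_twisted_derivations_def additive_twisted_derivations_def twist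
        elim!: set_plus_elim intro!: incidence.twisted_derivations_plus)
qed

end

theorem corollary2p9:
  fixes \<beta> \<sigma> :: "('a::locally_finite_order, 'k::field) incidence"
    and \<alpha> :: "'a \<Rightarrow> 'a"
    and \<phi> \<psi> :: "('a, 'k) incidence \<Rightarrow> ('a, 'k) incidence"
  assumes "invertible_elem \<beta>"
    and "multiplicative \<sigma>"
    and "\<alpha> \<in> order_automorphisms"
    and "\<psi> = mult_auto \<sigma> \<circ> induced_auto \<alpha>"
    and "\<phi> = inner_auto \<beta> \<circ> \<psi>"
  shows "twisted_derivations scale_incidence \<phi> =
    inner_twisted_derivations \<phi> + left_multiples \<beta> (additive_twisted_derivations \<sigma> \<alpha>)"
proof -
  have "twisted_derivations scale_incidence \<phi> =
      left_multiples \<beta> (twisted_derivations scale_incidence \<psi>)"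
    using incidence.left_multiples_twisted_derivations[OF assms(1)] assms(5) by simp
  also have "\<dots> = left_multiples \<beta> (inner_twisted_derivations \<psi>) +
      left_multiples \<beta> (additive_twisted_derivations \<sigma> \<alpha>)"
    by (simp only: twisted_derivations_inner_plus_additive[OF assms(2-4)] left_multiples_set_plus)
  also have "left_multiples \<beta> (inner_twisted_derivations \<psi>) = inner_twisted_derivations \<phi>"
    using left_multiples_inner_twisted_derivations[OF assms(1)] assms(5) by simp
  finally show ?thesis .
qed

end
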